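(* Let $0<a<b$, $s\in(0,1)$, $p>1$ and $\frac1p+\frac1q=1$. Write $A=A(a,b)$. Then $$\left|A^s(a,b)-L_s^s(a,b)\right|\le s\,\frac{b-a}{4}\,\frac{1}{(p+1)^{1/p}}\left[\Big(\frac{A^{q(s-1)}+b^{q(s-1)}}{s+1}\Big)^{1/q}+\Big(\frac{a^{q(s-1)}+A^{q(s-1)}}{s+1}\Big)^{1/q}\right].$$
   Context: For positive reals $a\neq b$: $A(a,b)=\frac{a+b}{2}$ is the arithmetic mean, and for $r\in\mathbb{R}\setminus\{-1,0\}$, $L_r(a,b)=\left[\frac{b^{r+1}-a^{r+1}}{(r+1)(b-a)}\right]^{1/r}$ is the $r$-logarithmic mean. $A^s(a,b)$ and $L_s^s(a,b)$ denote $(A(a,b))^s$ and $(L_s(a,b))^s$. *)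

theory Defs
  imports Complex_Main
begin

definition arith_mean :: "real \<Rightarrow> real \<Rightarrow> real" where
  "arith_mean a b = (a + b) / 2"

(* Meaningful for a, b > 0 with a \<noteq> b and r \<notin> {-1, 0}; the base of the outer
   power is then positive, so powr is the usual real power. *)
definition log_mean :: "real \<Rightarrow> real \<Rightarrow> real \<Rightarrow> real" where
  "log_mean r a b =
     ((b powr (r + 1) - a powr (r + 1)) / ((r + 1) * (b - a))) powr (1 / r)"

end

theory Submission
  imports Defs "HOL-Analysis.Convex"
begin

text \<open>
  The number \<open>L\<^sub>s\<^sup>s\<close> is the mean of the concave increasing function \<open>f(x) = x\<^sup>s\<close> over \<open>[a, b]\<close>, so the
  Hermite-Hadamard inequality gives \<open>L\<^sub>s\<^sup>s \<le> A\<^sup>s\<close>, and applied on \<open>[a, A]\<close> together with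
  \<open>f \<ge> f(A)\<close> on \<open>[A, b]\<close> it gives \<open>A\<^sup>s - L\<^sub>s\<^sup>s \<le> (A\<^sup>s - a\<^sup>s) / 4\<close>. Since \<open>f'\<close> is convex,
  Hermite-Hadamard once more bounds \<open>A\<^sup>s - a\<^sup>s\<close> by \<open>s (b - a) / 2\<close> times the arithmetic mean of
  \<open>a\<^bsup>s-1\<^esup>\<close> and \<open>A\<^bsup>s-1\<^esup>\<close>, which is at most their \<open>q\<close>-th power mean. The second summand on the
  right-hand side is then simply dropped, and \<open>(p + 1)\<^bsup>1/p\<^esup> \<le> 2\<close>.
\<close>

text \<open>Working with an antiderivative \<open>F\<close> avoids integrals. A convex
  \<open>f\<close> lies below its chord, so the antiderivative \<open>G\<close> of chord minus
  \<open>f\<close> is nondecreasing.\<close>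

lemma hermite_hadamard_trapezoid:
  fixes f F :: "real \<Rightarrow> real"
  assumes "a < b"
    and conv: "convex_on {a..b} f"
    and deriv: "\<And>x. x \<in> {a..b} \<Longrightarrow> (F has_real_derivative f x) (at x)"
  shows "F b - F a \<le> (b - a) * ((f a + f b) / 2)"
proof -
  define k where "k = (f b - f a) / (b - a)"
  define G where "G = (\<lambda>x. f a * (x - a) + k * (x - a)\<^sup>2 / 2 - F x)"
  have "G a \<le> G b"
  proof (rule DERIV_nonneg_imp_nondecreasing[where f = G])
    fix x assume x: "a \<le> x" "x \<le> b"
    have "(G has_real_derivative f a + k * (x - a) - f x) (at x)"
      unfolding G_def using deriv[of x] x
      by (auto intro!: derivative_eq_intros)
    moreover have "f x \<le> f a + k * (x - a)"
      using convex_onD_Icc'[OF conv, of x] x by (simp add: k_def algebra_simps)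
    ultimately show "\<exists>y. (G has_real_derivative y) (at x) \<and> 0 \<le> y"
      by auto
  qed (use \<open>a < b\<close> in simp)
  moreover have "k * (b - a)\<^sup>2 = (f b - f a) * (b - a)"
    using \<open>a < b\<close> by (simp add: k_def power2_eq_square)
  ultimately show ?thesis
    by (simp add: G_def field_simps)
qed

text \<open>The interval grows symmetrically about the midpoint \<open>m\<close>: \<open>G t\<close>
  is the excess of the increment of \<open>F\<close> over [m - t, m + t] above
  \<open>2 * t * f m\<close>, and midpoint convexity makes its derivative nonnegative.\<close>

lemma hermite_hadamard_midpoint:
  fixes f F :: "real \<Rightarrow> real"
  assumes "a < b"
    and conv: "convex_on {a..b} f"
    and deriv: "\<And>x. x \<in> {a..b} \<Longrightarrow> (F has_real_derivative f x) (at x)"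
  shows "(b - a) * f ((a + b) / 2) \<le> F b - F a"
proof -
  define m h where "m = (a + b) / 2" and "h = (b - a) / 2"
  have ends: "m + h = b" "m - h = a" and "0 < h"
    using \<open>a < b\<close> by (auto simp: m_def h_def field_simps)
  define G where "G = (\<lambda>t. F (m + t) - F (m - t) - 2 * t * f m)"
  have "G 0 \<le> G h"
  proof (rule DERIV_nonneg_imp_nondecreasing[where f = G])
    fix t assume t: "0 \<le> t" "t \<le> h"
    then have mem: "m + t \<in> {a..b}" "m - t \<in> {a..b}"
      using ends by auto
    have "((\<lambda>t. F (m + t)) has_real_derivative f (m + t) * 1) (at t)"
      by (rule DERIV_chain2[where f = F]) (auto intro!: derivative_eq_intros deriv mem)
    moreover have "((\<lambda>t. F (m - t)) has_real_derivative f (m - t) * (- 1)) (at t)"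
      by (rule DERIV_chain2[where f = F]) (auto intro!: derivative_eq_intros deriv mem)
    ultimately have "(G has_real_derivative f (m + t) + f (m - t) - 2 * f m) (at t)"
      unfolding G_def by (auto intro!: derivative_eq_intros)
    moreover have "2 * f m \<le> f (m + t) + f (m - t)"
      using convex_onD[OF conv, of "1/2" "m + t" "m - t"] mem by (simp add: field_simps)
    ultimately show "\<exists>y. (G has_real_derivative y) (at t) \<and> 0 \<le> y"
      by auto
  qed (use \<open>0 < h\<close> in simp)
  then have "2 * h * f m \<le> F b - F a"
    by (simp add: G_def ends)
  moreover have "2 * h = b - a"
    by (simp add: h_def)
  ultimately show ?thesis
    unfolding m_def by (simp only:)
qed

lemma powr_convex_nonpos:
  fixes r :: real
  assumes "r \<le> 0"
  shows "convex_on {0<..} (\<lambda>x. x powr r)"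
proof (rule f''_ge0_imp_convex)
  fix x :: real assume "x \<in> {0<..}"
  then show "((\<lambda>x. x powr r) has_real_derivative r * x powr (r - 1)) (at x)"
    and "((\<lambda>x. r * x powr (r - 1)) has_real_derivative r * ((r - 1) * x powr (r - 1 - 1))) (at x)"
    by (intro DERIV_cmult has_real_derivative_powr; simp)+
  show "0 \<le> r * ((r - 1) * x powr (r - 1 - 1))"
    using assms by (intro mult_nonpos_nonpos mult_nonpos_nonneg) auto
qed simp

text \<open>Concavity is phrased through the negated function so that both Hermite-Hadamard lemmas
  apply directly, with a negated antiderivative.\<close>

lemma powr_concave:
  fixes r :: real
  assumes "0 \<le> r" "r \<le> 1"
  shows "convex_on {0<..} (\<lambda>x. - (x powr r))"
proof (rule f''_ge0_imp_convex)
  fix x :: real assume "x \<in> {0<..}"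
  then show "((\<lambda>x. - (x powr r)) has_real_derivative - r * x powr (r - 1)) (at x)"
    and "((\<lambda>x. - r * x powr (r - 1)) has_real_derivative - r * ((r - 1) * x powr (r - 1 - 1))) (at x)"
    by (auto intro!: derivative_eq_intros has_real_derivative_powr DERIV_cmult)
  show "0 \<le> - r * ((r - 1) * x powr (r - 1 - 1))"
    using assms by (intro mult_nonpos_nonpos mult_nonpos_nonneg) auto
qed simp

lemma arith_mean_le_power_mean:
  fixes u v q :: real
  assumes "0 < u" "0 < v" "1 \<le> q"
  shows "(u + v) / 2 \<le> ((u powr q + v powr q) / 2) powr (1 / q)"
proof -
  have "((u + v) / 2) powr q \<le> (u powr q + v powr q) / 2"
    using convex_onD[OF powr_convex[OF \<open>1 \<le> q\<close>], of "1/2" u v] assms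
    by (simp add: field_simps)
  then have "(((u + v) / 2) powr q) powr (1 / q) \<le> ((u powr q + v powr q) / 2) powr (1 / q)"
    using assms by (intro powr_mono2) auto
  then show ?thesis
    using assms by (simp add: powr_powr)
qed

text \<open>Weighted AM-GM for \<open>p + 1\<close> and 1 with weights \<open>1 / p\<close> and
  \<open>1 - 1 / p\<close>; the weighted arithmetic mean is exactly 2.\<close>

lemma powr_inverse_le_two:
  fixes p :: real
  assumes "1 \<le> p"
  shows "(p + 1) powr (1 / p) \<le> 2"
proof -
  have "(p + 1) powr (1 / p) * 1 powr (1 - 1 / p) \<le> 1 / p * (p + 1) + (1 - 1 / p) * 1"
    using assms by (intro Youngs_inequality_0) auto
  then show ?thesis
    using assms by (simp add: field_simps)
qed

lemma log_mean_powr_self: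
  assumes "0 < a" "a < b" "0 < s"
  shows "log_mean s a b powr s = (b powr (s + 1) - a powr (s + 1)) / ((s + 1) * (b - a))"
proof -
  \<comment> \<open>This makes the base positive, so raising it to \<open>1 / s\<close> and then to
    \<open>s\<close> returns it unchanged.\<close>
  have "a powr (s + 1) < b powr (s + 1)"
    using assms by (intro powr_less_mono2) auto
  then show ?thesis
    using assms by (simp add: log_mean_def powr_powr)
qed

lemma arith_mean_powr_minus_log_mean_powr:
  fixes a b s :: real
  assumes "0 < a" "a < b" "0 < s" "s < 1"
  defines "A \<equiv> arith_mean a b"
  shows "log_mean s a b powr s \<le> A powr s"
    and "A powr s - log_mean s a b powr s \<le> (A powr s - a powr s) / 4"
proof -
  have A: "a < A" "A < b" "A = (a + b) / 2"
    using assms by (auto simp: A_def arith_mean_def)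
  define F where "F = (\<lambda>x::real. x powr (s + 1) / (s + 1))"
  have F: "(F has_real_derivative x powr s) (at x)" if "0 < x" for x
    using DERIV_cdivide[OF has_real_derivative_powr[OF that, of "s + 1"], of "s + 1"] \<open>0 < s\<close>
    by (simp add: F_def)
  have nF: "((\<lambda>x. - F x) has_real_derivative - (x powr s)) (at x)" if "0 < x" for x
    using F[OF that] by (rule DERIV_minus)
  have conv: "convex_on {c..d} (\<lambda>x. - (x powr s))" if "0 < c" for c d
    by (rule convex_on_subset[OF powr_concave]) (use assms that in auto)
  have mean: "log_mean s a b powr s = (F b - F a) / (b - a)"
    using assms by (simp add: log_mean_powr_self F_def diff_divide_distrib[symmetric])
  have "F b - F a \<le> (b - a) * A powr s"
    using hermite_hadamard_midpoint[OF \<open>a < b\<close> conv nF] \<open>0 < a\<close> by (simp add: A)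
  then show "log_mean s a b powr s \<le> A powr s"
    using assms by (simp add: mean field_simps)
  have left: "(A - a) * ((a powr s + A powr s) / 2) \<le> F A - F a"
    using hermite_hadamard_trapezoid[OF \<open>a < A\<close> conv nF] \<open>0 < a\<close> by (simp add: field_simps)
  \<comment> \<open>Antiderivative form of bounding the integral of \<open>x powr s\<close> over
    [A, b] below by \<open>(b - A) * A powr s\<close>.\<close>
  have "F A - A powr s * A \<le> F b - A powr s * b"
  proof (rule DERIV_nonneg_imp_nondecreasing[where f = "\<lambda>x. F x - A powr s * x"])
    fix x assume "A \<le> x" "x \<le> b"
    then have "((\<lambda>x. F x - A powr s * x) has_real_derivative x powr s - A powr s) (at x)"
      and "A powr s \<le> x powr s"
      using A assms(1-4) by (auto intro!: derivative_eq_intros F powr_mono2)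
    then show "\<exists>y. ((\<lambda>x. F x - A powr s * x) has_real_derivative y) (at x) \<and> 0 \<le> y"
      by auto
  qed (use A in simp)
  \<comment> \<open>Both halves have length \<open>(b - a) / 2\<close>: the left one contributes a
    quarter each of \<open>a powr s\<close> and \<open>A powr s\<close>, the right one half of
    \<open>A powr s\<close>.\<close>
  with left have "(b - a) * ((a powr s + 3 * A powr s) / 4) \<le> F b - F a"
    unfolding A(3) by (simp add: field_simps)
  then have "(a powr s + 3 * A powr s) / 4 \<le> log_mean s a b powr s"
    using assms by (simp add: mean pos_le_divide_eq mult.commute)
  then show "A powr s - log_mean s a b powr s \<le> (A powr s - a powr s) / 4"
    by simp
qed

theorem proposition2:
  fixes a b s p q :: real
  assumes "0 < a" and "a < b"
    and "0 < s" and "s < 1"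
    and "1 < p" and "1 / p + 1 / q = 1"
  shows "\<bar>arith_mean a b powr s - log_mean s a b powr s\<bar>
    \<le> s * ((b - a) / 4) * (1 / (p + 1) powr (1 / p)) *
      (((arith_mean a b powr (q * (s - 1)) + b powr (q * (s - 1))) / (s + 1)) powr (1 / q)
       + ((a powr (q * (s - 1)) + arith_mean a b powr (q * (s - 1))) / (s + 1)) powr (1 / q))"
    (is "_ \<le> _ * (?T1 + ?T2)")
proof -
  define A where "A = arith_mean a b"
  have A: "a < A" "A - a = (b - a) / 2"
    using assms by (auto simp: A_def arith_mean_def field_simps)
  have "1 / q = 1 - 1 / p" "0 < 1 / p" "1 / p < 1"
    using assms by auto
  then have "0 < 1 / q" "1 / q < 1"
    by linarith+
  then have "1 < q"
    by (simp add: divide_less_eq split: if_splits)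
  have "A powr s - a powr s \<le> (A - a) * ((s * a powr (s - 1) + s * A powr (s - 1)) / 2)"
  proof (rule hermite_hadamard_trapezoid[OF \<open>a < A\<close>])
    show "convex_on {a..A} (\<lambda>x. s * x powr (s - 1))"
      using assms by (intro convex_on_cmul convex_on_subset[OF powr_convex_nonpos]) auto
  qed (use assms in \<open>auto intro!: has_real_derivative_powr\<close>)
  also have "\<dots> = s * (A - a) * ((a powr (s - 1) + A powr (s - 1)) / 2)"
    by (simp add: algebra_simps)
  also have "\<dots> \<le> s * (A - a) * ?T2"
  proof (rule mult_left_mono)
    have "(a powr (s - 1) + A powr (s - 1)) / 2
        \<le> (((a powr (s - 1)) powr q + (A powr (s - 1)) powr q) / 2) powr (1 / q)"
      using assms A \<open>1 < q\<close> by (intro arith_mean_le_power_mean) auto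
    also have "\<dots> = ((a powr (q * (s - 1)) + A powr (q * (s - 1))) / 2) powr (1 / q)"
      by (simp add: powr_powr mult.commute)
    \<comment> \<open>Since \<open>s < 1\<close>, the denominator 2 may be lowered to
      \<open>s + 1\<close>.\<close>
    also have "\<dots> \<le> ?T2"
      using assms \<open>1 < q\<close> unfolding A_def
      by (intro powr_mono2 divide_left_mono) auto
    finally show "(a powr (s - 1) + A powr (s - 1)) / 2 \<le> ?T2" .
  qed (use assms A in auto)
  finally have incr: "A powr s - a powr s \<le> s * ((b - a) / 2) * ?T2"
    using A by simp
  have const: "1 / 2 \<le> 1 / (p + 1) powr (1 / p)"
    using powr_inverse_le_two[of p] \<open>1 < p\<close> by (intro divide_left_mono) auto
  have "\<bar>A powr s - log_mean s a b powr s\<bar> \<le> (A powr s - a powr s) / 4"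
    using arith_mean_powr_minus_log_mean_powr[of a b s] assms by (simp add: A_def)
  \<comment> \<open>The factor \<open>1 / 2\<close> is split off to be compared with the constant in
    \<open>p\<close>.\<close>
  also have "\<dots> \<le> s * ((b - a) / 4) * (1 / 2) * ?T2"
    using incr by simp
  also have "\<dots> \<le> s * ((b - a) / 4) * (1 / (p + 1) powr (1 / p)) * (?T1 + ?T2)"
    using assms const by (intro mult_mono) auto
  finally show ?thesis
    unfolding A_def .
qed

end
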